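(* Let $X$ be a GCB-space with Property (C) and let $\Gamma$ be a countable discrete group acting on $X$ by bicombing respecting isometries. Suppose there is a point $x_0\in X$ whose orbit $\Gamma x_0$ is bounded and such that the restricted action of $\Gamma$ on the set $\Gamma x_0$ is amenable. Then there is a point $\tilde x\in X$ with $\gamma\tilde x=\tilde x$ for all $\gamma\in\Gamma$ which is convex close to $\mathrm{conv}(\Gamma x_0)$.
   Context: A geodesic bicombing on a metric space $(X,d)$ (in which any two points are joined by a geodesic) is a map $\eta:X\times X\times[0,1]\to X$ such that: (i) for all $x,y$, $\eta(x,y,\cdot)$ is a geodesic from $x$ to $y$; (ii) $\eta(y,x,t)=\eta(x,y,1-t)$; (iii) $\eta(x,\eta(x,y,t),s)=\eta(x,y,ts)$; (iv) $\lim_n\eta(x_n,y_n,t)=\eta(\lim_n x_n,\lim_n y_n,t)$ for all $t$ and all convergent sequences. A GCB-space is a complete metric space $(X,d)$ with a fixed geodesic bicombing $\eta$ such that $d(\eta(x_1,x_2,t),\eta(y_1,y_2,t))\leq t\,d(x_2,y_2)+(1-t)\,d(x_1,y_1)$ for all $x_i,y_i\in X$, $t\in[0,1]$. A map $f:X\to X$ is bicombing respecting if $f(\eta(x,y,t))=\eta(f(x),f(y),t)$ for all $x,y,t$. A set $A\subset X$ is convex if $\eta(x,y,t)\in A$ for all $x,y\in A$, $t\in[0,1]$; $\mathrm{conv}(A)$ is the smallest closed convex set containing $A$. A point $x$ is convex close to $A\subset X$ if $d(x,a)\leq\mathrm{diam}(A)$ for all $a\in A$. Property (C): given a bounded sequence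 $(x_n)_{n\in\mathbb N}$ in $X$ and a family $\{f_\alpha:\alpha\in I\}$ of bicombing respecting isometries of $X$ such that $d(x_n,f_\alpha(x_n))\to0$ for every $\alpha\in I$, there is $x\in X$, convex close to $\{x_n:n\in\mathbb N\}$, with $f_\alpha(x)=x$ for all $\alpha\in I$. An action of a countable discrete group $\Gamma$ on a set $Y$ is amenable if for every finite $S\subset\Gamma$ and $\epsilon>0$ there is a finite set $A\subset Y$ with $|A\,\Delta\,\gamma A|<\epsilon|A|$ for all $\gamma\in S$. *)

theory Defs
  imports "HOL-Analysis.Analysis" "HOL-Algebra.Group_Action"
begin

text \<open>
  Geodesics are parametrised on \<open>[0,1]\<close> proportionally to arc length.
\<close>

definition geodesic_from_to :: "(real \<Rightarrow> 'a::metric_space) \<Rightarrow> 'a \<Rightarrow> 'a \<Rightarrow> bool" where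
  "geodesic_from_to c x y \<longleftrightarrow> c 0 = x \<and> c 1 = y \<and>
     (\<forall>s\<in>{0..1}. \<forall>t\<in>{0..1}. dist (c s) (c t) = \<bar>s - t\<bar> * dist x y)"

text \<open>
  The third argument of a bicombing is only meaningful in \<open>[0,1]\<close>.  That any two points are
  joined by a geodesic is part of \<open>geodesic\<close> below.
\<close>

locale geodesic_bicombing =
  fixes \<eta> :: "'a::metric_space \<Rightarrow> 'a \<Rightarrow> real \<Rightarrow> 'a"
  assumes geodesic: "geodesic_from_to (\<eta> x y) x y"
    and reverse: "t \<in> {0..1} \<Longrightarrow> \<eta> y x t = \<eta> x y (1 - t)"
    and subgeodesic: "s \<in> {0..1} \<Longrightarrow> t \<in> {0..1} \<Longrightarrow> \<eta> x (\<eta> x y t) s = \<eta> x y (t * s)"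
    and continuous: "t \<in> {0..1} \<Longrightarrow> u \<longlonglongrightarrow> x \<Longrightarrow> v \<longlonglongrightarrow> y \<Longrightarrow>
      (\<lambda>n. \<eta> (u n) (v n) t) \<longlonglongrightarrow> \<eta> x y t"

locale GCB_space = geodesic_bicombing \<eta>
  for \<eta> :: "'a::complete_space \<Rightarrow> 'a \<Rightarrow> real \<Rightarrow> 'a" +
  assumes dist_le: "t \<in> {0..1} \<Longrightarrow>
      dist (\<eta> x1 x2 t) (\<eta> y1 y2 t) \<le> t * dist x2 y2 + (1 - t) * dist x1 y1"

definition bicombing_respecting ::
  "('a \<Rightarrow> 'a \<Rightarrow> real \<Rightarrow> 'a) \<Rightarrow> ('a \<Rightarrow> 'a) \<Rightarrow> bool" where
  "bicombing_respecting \<eta> f \<longleftrightarrow> (\<forall>x y. \<forall>t\<in>{0..1}. f (\<eta> x y t) = \<eta> (f x) (f y) t)"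

text \<open>
  An isometry of a space is a distance preserving map of the space onto itself.
\<close>

definition isometry_of_space :: "('a::metric_space \<Rightarrow> 'a) \<Rightarrow> bool" where
  "isometry_of_space f \<longleftrightarrow> surj f \<and> (\<forall>x y. dist (f x) (f y) = dist x y)"

definition bicombing_convex :: "('a \<Rightarrow> 'a \<Rightarrow> real \<Rightarrow> 'a) \<Rightarrow> 'a set \<Rightarrow> bool" where
  "bicombing_convex \<eta> A \<longleftrightarrow> (\<forall>x\<in>A. \<forall>y\<in>A. \<forall>t\<in>{0..1}. \<eta> x y t \<in> A)"

definition closed_conv ::
  "('a::metric_space \<Rightarrow> 'a \<Rightarrow> real \<Rightarrow> 'a) \<Rightarrow> 'a set \<Rightarrow> 'a set" where
  "closed_conv \<eta> A = (\<lambda>C. closed C \<and> bicombing_convex \<eta> C) hull A"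

text \<open>
  The real-valued \<^const>\<open>diameter\<close> is the usual one only on bounded sets.  Convex closeness is
  only used for such sets: the range of a bounded sequence, and the closed convex hull of a
  bounded set in a GCB-space, which is bounded because closed balls are convex.
\<close>

definition convex_close :: "'a::metric_space \<Rightarrow> 'a set \<Rightarrow> bool" where
  "convex_close x A \<longleftrightarrow> (\<forall>a\<in>A. dist x a \<le> diameter A)"

text \<open>
  Only the set of members of the family \<open>(f\<^sub>\<alpha>)\<close> matters in Property (C), so families over
  arbitrary index sets are rendered as arbitrary sets \<open>F\<close> of maps.
\<close>

definition property_C :: "('a::metric_space \<Rightarrow> 'a \<Rightarrow> real \<Rightarrow> 'a) \<Rightarrow> bool" where
  "property_C \<eta> \<longleftrightarrow>
     (\<forall>(x :: nat \<Rightarrow> 'a) (F :: ('a \<Rightarrow> 'a) set).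
        bounded (range x) \<longrightarrow>
        (\<forall>f\<in>F. isometry_of_space f \<and> bicombing_respecting \<eta> f) \<longrightarrow>
        (\<forall>f\<in>F. (\<lambda>n. dist (x n) (f (x n))) \<longlonglongrightarrow> 0) \<longrightarrow>
        (\<exists>z. convex_close z (range x) \<and> (\<forall>f\<in>F. f z = z)))"

definition amenable_action ::
  "('g, 'r) monoid_scheme \<Rightarrow> 'b set \<Rightarrow> ('g \<Rightarrow> 'b \<Rightarrow> 'b) \<Rightarrow> bool" where
  "amenable_action G Y \<psi> \<longleftrightarrow>
     (\<forall>S \<epsilon>. finite S \<longrightarrow> S \<subseteq> carrier G \<longrightarrow> (0::real) < \<epsilon> \<longrightarrow>
        (\<exists>A. finite A \<and> A \<subseteq> Y \<and>
           (\<forall>g\<in>S. real (card (sym_diff A (\<psi> g ` A))) < \<epsilon> * real (card A))))"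

end

theory Submission
  imports Defs "HOL-Library.Multiset"
begin

text \<open>
  Barycentres in the style of Es-Sahib and Heinich are built by induction on the number of points:
  replace each point of a multiset by the barycentre of the remaining ones and iterate.  The
  diameter halves in each step, so the multiset shrinks to a point, and the cost of a coupling of
  two multisets does not increase.  Hence the barycentre is equivariant and 1-Lipschitz for the
  transport distance between multisets of the same size.  The barycentres of Foelner sets of the
  orbit, all of which lie in its closed convex hull, are therefore asymptotically fixed, and
  Property (C) applies.
\<close>

section \<open>Couplings of finite multisets\<close>

text \<open>A multiset of pairs is a matching of its images under \<open>fst\<close> and
  \<open>snd\<close>. Both images have the same size, so a coupling of uniform weights needs no
  explicit weights.\<close>

definition coupling_cost :: "('a::metric_space \<times> 'a) multiset \<Rightarrow> real" where
  "coupling_cost P = (\<Sum>p\<in>#P. dist (fst p) (snd p))"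

lemma coupling_cost_add_mset [simp]:
  "coupling_cost (add_mset p P) = dist (fst p) (snd p) + coupling_cost P"
  by (simp add: coupling_cost_def)

lemma coupling_cost_empty [simp]: "coupling_cost {#} = 0"
  by (simp add: coupling_cost_def)

lemma coupling_cost_diagonal [simp]: "coupling_cost {#(x, x). x \<in># M#} = 0"
  by (induction M) auto

text \<open>Every occurrence is omitted from exactly one of the \<open>size P\<close> inner sums,
  hence counted \<open>size P - 1\<close> times. The subtraction is real, so the empty multiset is
  covered as well.\<close>

lemma sum_mset_remove1:
  fixes c :: "'b \<Rightarrow> real"
  shows "(\<Sum>p\<in>#P. \<Sum>q\<in>#P - {#p#}. c q) = (real (size P) - 1) * (\<Sum>p\<in>#P. c p)"
proof -
  define S where "S = (\<Sum>p\<in>#P. c p)"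
  have "(\<Sum>q\<in>#P - {#p#}. c q) = S - c p" if "p \<in># P" for p
  proof -
    from that obtain Q where "P = add_mset p Q" by (rule mset_add)
    then show ?thesis by (simp add: S_def)
  qed
  then have "(\<Sum>p\<in>#P. \<Sum>q\<in>#P - {#p#}. c q) = (\<Sum>p\<in>#P. S - c p)"
    by (intro arg_cong[where f = sum_mset] image_mset_cong) auto
  also have "\<dots> = real (size P) * S - (\<Sum>p\<in>#P. c p)"
    by (induction P) (auto simp: algebra_simps)
  finally show ?thesis by (simp add: S_def algebra_simps)
qed

section \<open>Constant geodesics and convexity of balls\<close>

context GCB_space
begin

lemma const [simp]:
  assumes "t \<in> {0..1}"
  shows "\<eta> x x t = x"
proof -
  note c = geodesic[of x x, unfolded geodesic_from_to_def]
  have "dist (\<eta> x x 0) (\<eta> x x t) = \<bar>0 - t\<bar> * dist x x"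
    by (intro c[THEN conjunct2, THEN conjunct2, rule_format]) (use assms in simp_all)
  then show ?thesis by (simp add: c[THEN conjunct1])
qed

text \<open>Comparing the geodesic from \<open>x\<close> to \<open>y\<close> with the constant
  geodesic at the centre bounds the distance to \<open>c\<close> by a convex combination of the
  distances at the endpoints.\<close>

lemma bicombing_convex_cball: "bicombing_convex \<eta> (cball c r)"
  unfolding bicombing_convex_def
proof (intro ballI)
  fix x y and t :: real assume "x \<in> cball c r" "y \<in> cball c r" and t: "t \<in> {0..1}"
  then have "t * dist c y + (1 - t) * dist c x \<le> t * r + (1 - t) * r"
    by (intro add_mono mult_left_mono) auto
  also have "\<dots> = r" by (simp add: algebra_simps)
  finally show "\<eta> x y t \<in> cball c r"
    using dist_le[OF t, of c c x y] t by simp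
qed

section \<open>Barycentre maps and the cases of one and two points\<close>

text \<open>The first clause is the 1-Lipschitz property for the transport distance between uniform
  measures on \<open>n\<close> points, cleared of the denominator \<open>n\<close>. Taking multisets
  as arguments builds in invariance under permutations.\<close>

definition barycentre_map :: "nat \<Rightarrow> ('a multiset \<Rightarrow> 'a) \<Rightarrow> bool" where
  "barycentre_map n b \<longleftrightarrow>
     (\<forall>P. size P = n \<longrightarrow>
        real n * dist (b (image_mset fst P)) (b (image_mset snd P)) \<le> coupling_cost P) \<and>
     (\<forall>M C. size M = n \<longrightarrow> set_mset M \<subseteq> C \<longrightarrow> closed C \<longrightarrow> bicombing_convex \<eta> C \<longrightarrow> b M \<in> C) \<and>
     (\<forall>M f. size M = n \<longrightarrow> isometry_of_space f \<longrightarrow> bicombing_respecting \<eta> f \<longrightarrow>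
        b (image_mset f M) = f (b M))"

lemma barycentre_map_dist:
  assumes "barycentre_map n b" "size P = n"
  shows "real n * dist (b (image_mset fst P)) (b (image_mset snd P)) \<le> coupling_cost P"
  using assms(1)[unfolded barycentre_map_def, THEN conjunct1, rule_format, OF assms(2)] .

lemma barycentre_map_in:
  assumes "barycentre_map n b" "size M = n" "set_mset M \<subseteq> C" "closed C" "bicombing_convex \<eta> C"
  shows "b M \<in> C"
  using assms(1)[unfolded barycentre_map_def, THEN conjunct2, THEN conjunct1, rule_format, OF assms(2-)] .

lemma barycentre_map_equivariant:
  assumes "barycentre_map n b" "size M = n" "isometry_of_space f" "bicombing_respecting \<eta> f"
  shows "b (image_mset f M) = f (b M)"
  using assms(1)[unfolded barycentre_map_def, THEN conjunct2, THEN conjunct2, rule_format, OF assms(2-)] .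

lemma barycentre_map_1: "\<exists>b. barycentre_map 1 b"
proof
  show "barycentre_map 1 (\<lambda>M. SOME x. x \<in># M)"
    unfolding barycentre_map_def
    by (auto dest!: size_1_singleton_mset[unfolded One_nat_def])
qed

lemma size_2_cases:
  assumes "size M = 2" obtains x y where "M = {#x, y#}"
proof -
  obtain x N where M: "M = add_mset x N"
    using size_eq_Suc_imp_eq_union[of M 1] assms by auto
  then have "size N = 1" using assms by simp
  then show thesis using that M size_1_singleton_mset by blast
qed

text \<open>The midpoint does not depend on the order of the two points, by \<open>reverse\<close>
  at 1/2, and \<open>dist_le\<close> at 1/2 is the transport estimate. Two points need a
  construction of their own: replacing each of them by the barycentre of the other only swaps them,
  so the iteration used for larger sizes would not contract.\<close>

lemma barycentre_map_2: "\<exists>b. barycentre_map 2 b"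
proof -
  define b where "b M = (SOME z. \<exists>x y. M = {#x, y#} \<and> z = \<eta> x y (1/2))" for M
  have b: "b {#x, y#} = \<eta> x y (1/2)" for x y
  proof -
    have "\<exists>x' y'. {#x, y#} = {#x', y'#} \<and> b {#x, y#} = \<eta> x' y' (1/2)"
      unfolding b_def by (rule someI_ex) blast
    then show ?thesis
      using reverse[of "1/2" x y] by (auto simp: add_eq_conv_ex)
  qed
  have "barycentre_map 2 b"
    unfolding barycentre_map_def
  proof (intro conjI allI impI)
    fix P :: "('a \<times> 'a) multiset" assume "size P = 2"
    then obtain p q where "P = {#p, q#}" by (rule size_2_cases)
    then show "real 2 * dist (b (image_mset fst P)) (b (image_mset snd P)) \<le> coupling_cost P"
      using dist_le[of "1/2" "fst p" "fst q" "snd p" "snd q"] by (simp add: b)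
  next
    fix M :: "'a multiset" and C assume "size M = 2" "set_mset M \<subseteq> C" "bicombing_convex \<eta> C"
    then show "b M \<in> C"
      by (auto elim!: size_2_cases simp: b bicombing_convex_def)
  next
    fix M :: "'a multiset" and f assume "size M = 2" "bicombing_respecting \<eta> f"
    then show "b (image_mset f M) = f (b M)"
      by (auto elim!: size_2_cases simp: b bicombing_respecting_def)
  qed
  then show ?thesis by blast
qed

section \<open>The iteration that shrinks a multiset to a point\<close>

definition replace_by_barycentres :: "('a multiset \<Rightarrow> 'a) \<Rightarrow> 'a multiset \<Rightarrow> 'a multiset" where
  "replace_by_barycentres b M = {#b (M - {#x#}). x \<in># M#}"

text \<open>The entries of a multiset carry no indexing to follow along \<open>k\<close>, so
  convergence is stated uniformly over all entries.\<close>

definition converges_to_point :: "(nat \<Rightarrow> 'a multiset) \<Rightarrow> 'a \<Rightarrow> bool" where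
  "converges_to_point T z \<longleftrightarrow> (\<forall>e>0. \<forall>\<^sub>F k in sequentially. \<forall>x\<in>#T k. dist x z < e)"

lemma converges_to_point_unique:
  assumes "converges_to_point T z" "converges_to_point T w" "\<And>k. T k \<noteq> {#}"
  shows "z = w"
proof (rule ccontr)
  assume "z \<noteq> w"
  define e where "e = dist z w / 2"
  have "e > 0" using \<open>z \<noteq> w\<close> by (simp add: e_def)
  then have "\<forall>\<^sub>F k in sequentially. (\<forall>x\<in>#T k. dist x z < e) \<and> (\<forall>x\<in>#T k. dist x w < e)"
    using assms unfolding converges_to_point_def by (intro eventually_conj) auto
  then obtain k where k: "\<forall>x\<in>#T k. dist x z < e" "\<forall>x\<in>#T k. dist x w < e"
    by (auto simp: eventually_sequentially)
  obtain x where "x \<in># T k" using assms(3) by blast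
  then have "dist z w < e + e"
    using k by (meson add_strict_mono dist_triangle3 order_le_less_trans)
  then show False by (simp add: e_def)
qed

text \<open>The multisets obtained by deleting \<open>x\<close> and \<open>y\<close> differ in one
  entry only. Matching \<open>y\<close> with \<open>x\<close> and all other entries with themselves
  costs \<open>dist x y\<close>, so the two barycentres are at distance at most
  \<open>dist x y / n\<close>.\<close>

lemma replace_by_barycentres_contracts:
  assumes b: "barycentre_map n b" and "size M = Suc n" "n \<ge> 2"
    and D: "\<And>x y. x \<in># M \<Longrightarrow> y \<in># M \<Longrightarrow> dist x y \<le> D"
    and u: "u \<in># replace_by_barycentres b M" and v: "v \<in># replace_by_barycentres b M"
  shows "dist u v \<le> D / 2"
proof -
  obtain x y where x: "x \<in># M" "u = b (M - {#x#})" and y: "y \<in># M" "v = b (M - {#y#})"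
    using u v by (auto simp: replace_by_barycentres_def)
  show ?thesis
  proof (cases "x = y")
    case True
    then show ?thesis using D[OF x(1) x(1)] x y by simp
  next
    case False
    then obtain K where M: "M = add_mset x (add_mset y K)"
      using x(1) y(1) by (metis insert_DiffM insert_noteq_member mset_add)
    define P where "P = add_mset (y, x) {#(z, z). z \<in># K#}"
    have "size P = n" using \<open>size M = Suc n\<close> by (simp add: P_def M)
    moreover have "image_mset fst P = M - {#x#}" "image_mset snd P = M - {#y#}"
      by (simp_all add: P_def M multiset.map_comp comp_def)
    ultimately have "real n * dist u v \<le> dist x y"
      using barycentre_map_dist[OF b, of P] x y by (simp add: P_def dist_commute)
    moreover have "2 * dist u v \<le> real n * dist u v"
      using \<open>n \<ge> 2\<close> by (intro mult_right_mono) auto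
    ultimately show ?thesis using D[OF x(1) y(1)] by simp
  qed
qed

text \<open>All entries lie in the closed ball of radius \<open>D\<close> about \<open>x\<close>,
  which is convex, so barycentres of entries stay in it.\<close>

lemma replace_by_barycentres_near:
  assumes b: "barycentre_map n b" and "size M = Suc n"
    and D: "\<And>x y. x \<in># M \<Longrightarrow> y \<in># M \<Longrightarrow> dist x y \<le> D"
    and "x \<in># M" and "u \<in># replace_by_barycentres b M"
  shows "dist x u \<le> D"
proof -
  obtain y where y: "y \<in># M" "u = b (M - {#y#})"
    using assms by (auto simp: replace_by_barycentres_def)
  have "u \<in> cball x D"
    unfolding y(2)
  proof (rule barycentre_map_in[OF b])
    show "size (M - {#y#}) = n" using y(1) \<open>size M = Suc n\<close> by (simp add: size_Diff_singleton)
    show "set_mset (M - {#y#}) \<subseteq> cball x D"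
      using D[OF \<open>x \<in># M\<close>] by (auto dest: in_diffD)
  qed (simp_all add: bicombing_convex_cball)
  then show ?thesis by simp
qed

lemma size_replace [simp]: "size (replace_by_barycentres b M) = size M"
  by (simp add: replace_by_barycentres_def)

lemma size_replace_iter [simp]: "size ((replace_by_barycentres b ^^ k) M) = size M"
  by (induction k) auto

text \<open>Diameters and distances between consecutive multisets are at most
  \<open>D / 2 ^ k\<close>. Hence any choice of one entry per step is a Cauchy sequence, and its
  limit attracts all other entries too.\<close>

lemma replace_by_barycentres_converges:
  assumes b: "barycentre_map n b" and M: "size M = Suc n" and "n \<ge> 2"
  shows "\<exists>z. converges_to_point (\<lambda>k. (replace_by_barycentres b ^^ k) M) z"
proof -
  define T where "T k = (replace_by_barycentres b ^^ k) M" for k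
  have T_Suc: "T (Suc k) = replace_by_barycentres b (T k)" for k by (simp add: T_def)
  have size_T: "size (T k) = Suc n" for k by (simp add: T_def M)
  define D where "D = diameter (set_mset M)"
  have diam: "dist x y \<le> D / 2 ^ k" if "x \<in># T k" "y \<in># T k" for x y k
    using that
  proof (induction k arbitrary: x y)
    case 0
    then show ?case by (auto simp: T_def D_def intro!: diameter_bounded_bound finite_imp_bounded)
  next
    case (Suc k)
    then show ?case
      using replace_by_barycentres_contracts[OF b size_T[of k] \<open>n \<ge> 2\<close>, of "D / 2 ^ k" x y]
      by (simp add: T_Suc field_simps)
  qed
  have next_near: "dist x u \<le> D / 2 ^ k" if "x \<in># T k" "u \<in># T (Suc k)" for x u k
    using replace_by_barycentres_near[OF b size_T[of k], of "D / 2 ^ k" x u] diam that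
    by (simp add: T_Suc)
  have "\<exists>x. x \<in># T k" for k using size_T[of k] by (metis Zero_not_Suc multiset_nonemptyE size_empty)
  then obtain p where p: "\<And>k. p k \<in># T k" by metis
  \<comment> \<open>The right-hand side is the closed form of the geometric sum of
    \<open>D / 2 ^ (k + j)\<close> over \<open>j < m\<close>.\<close>
  have "dist (p k) (p (k + m)) \<le> D / 2 ^ k * 2 * (1 - 1 / 2 ^ m)" for k m
  proof (induction m)
    case (Suc m)
    have "dist (p k) (p (k + Suc m)) \<le> dist (p k) (p (k + m)) + D / 2 ^ (k + m)"
      using next_near[OF p p, of "k + m"] dist_triangle[of "p k" "p (k + Suc m)" "p (k + m)"] by simp
    also have "\<dots> \<le> D / 2 ^ k * 2 * (1 - 1 / 2 ^ m) + D / 2 ^ (k + m)"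
      using Suc by simp
    also have "\<dots> = D / 2 ^ k * 2 * (1 - 1 / 2 ^ Suc m)"
      by (simp add: field_simps power_add)
    finally show ?case .
  qed simp
  moreover have "D \<ge> 0" by (simp add: D_def diameter_ge_0 finite_imp_bounded)
  then have "D / 2 ^ k * 2 * (1 - 1 / 2 ^ m) \<le> D / 2 ^ k * 2" for k m :: nat
    by (intro mult_left_le) auto
  ultimately have near: "dist (p k) (p (k + m)) < e" if "D / 2 ^ k * 2 < e" for k m e
    using that by (meson order_trans order_le_less_trans)
  have lim0: "(\<lambda>k. D / 2 ^ k * c) \<longlonglongrightarrow> 0" for c
    using tendsto_mult[OF tendsto_mult[OF tendsto_const LIMSEQ_power_zero[of "1/2::real"]] tendsto_const, of D c]
    by (simp add: power_one_over field_simps)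
  have "Cauchy p"
  proof (rule metric_CauchyI)
    fix e :: real assume "e > 0"
    then have "\<forall>\<^sub>F k in sequentially. D / 2 ^ k * 2 < e / 2"
      using order_tendstoD(2)[OF lim0] half_gt_zero by blast
    then obtain k where k: "D / 2 ^ k * 2 < e / 2" by (auto simp: eventually_sequentially)
    have "dist (p i) (p j) < e" if "i \<ge> k" "j \<ge> k" for i j
      using near[OF k, of "i - k"] near[OF k, of "j - k"] that dist_triangle3[of "p i" "p j" "p k"] by simp
    then show "\<exists>M. \<forall>m\<ge>M. \<forall>n\<ge>M. dist (p m) (p n) < e" by blast
  qed
  then obtain z where z: "p \<longlonglongrightarrow> z" using Cauchy_convergent convergentD by blast
  have "converges_to_point T z"
    unfolding converges_to_point_def
  proof (intro allI impI)
    fix e :: real assume "e > 0"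
    then have "\<forall>\<^sub>F k in sequentially. D / 2 ^ k < e / 2" "\<forall>\<^sub>F k in sequentially. dist (p k) z < e / 2"
      using order_tendstoD(2)[OF lim0, of "e / 2" 1] tendstoD[OF z, of "e / 2"] unfolding mult_1_right by simp_all
    then show "\<forall>\<^sub>F k in sequentially. \<forall>x\<in>#T k. dist x z < e"
    proof eventually_elim
      case (elim k)
      show ?case
      proof
        fix x assume "x \<in># T k"
        then have "dist x (p k) < e / 2" using diam[OF _ p, of x k] elim(1) by linarith
        then show "dist x z < e" using elim(2) dist_triangle[of x z "p k"] by linarith
      qed
    qed
  qed
  then show ?thesis unfolding T_def by blast
qed

text \<open>Deleting a pair \<open>p\<close> from \<open>P\<close> leaves a coupling of the two
  reduced multisets, so the distance of their barycentres is at most \<open>1/n\<close> times its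
  cost. Summed over \<open>p\<close>, every pair is counted \<open>n\<close> times, which cancels
  the factor \<open>1/n\<close>.\<close>

lemma replace_by_barycentres_coupling:
  assumes b: "barycentre_map n b" and P: "size P = Suc n" and "n \<ge> 1"
  shows "\<exists>Q. size Q = Suc n \<and> image_mset fst Q = replace_by_barycentres b (image_mset fst P) \<and>
    image_mset snd Q = replace_by_barycentres b (image_mset snd P) \<and>
    coupling_cost Q \<le> coupling_cost P"
proof (intro exI conjI)
  define F where "F p = b (image_mset fst (P - {#p#}))" for p
  define S where "S p = b (image_mset snd (P - {#p#}))" for p
  define Q where "Q = {#(F p, S p). p \<in># P#}"
  show "size Q = Suc n" by (simp add: Q_def P)
  show "image_mset fst Q = replace_by_barycentres b (image_mset fst P)"
    unfolding Q_def replace_by_barycentres_def F_def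
    by (simp add: multiset.map_comp comp_def image_mset_Diff cong: image_mset_cong)
  show "image_mset snd Q = replace_by_barycentres b (image_mset snd P)"
    unfolding Q_def replace_by_barycentres_def S_def
    by (simp add: multiset.map_comp comp_def image_mset_Diff cong: image_mset_cong)
  have "real n * coupling_cost Q = (\<Sum>p\<in>#P. real n * dist (F p) (S p))"
    by (simp add: coupling_cost_def Q_def multiset.map_comp comp_def sum_mset_distrib_left)
  also have "\<dots> \<le> (\<Sum>p\<in>#P. coupling_cost (P - {#p#}))"
    using b P unfolding barycentre_map_def F_def S_def
    by (intro sum_mset_mono) (auto simp: size_Diff_singleton)
  also have "\<dots> = real n * coupling_cost P"
    unfolding coupling_cost_def sum_mset_remove1 by (simp add: P)
  finally show "coupling_cost Q \<le> coupling_cost P" using \<open>n \<ge> 1\<close> by simp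
qed

section \<open>Induction on the number of points\<close>

text \<open>The new barycentre is the point to which the iterates of \<open>R\<close> shrink.
  Couplings of no greater cost, membership in closed convex sets and compatibility with isometries
  are inherited by all iterates and survive in the limit.\<close>

lemma barycentre_map_Suc:
  assumes b: "barycentre_map n b" and n: "n \<ge> 2"
  shows "\<exists>b'. barycentre_map (Suc n) b'"
proof -
  define R where "R = replace_by_barycentres b"
  define b' where "b' M = (SOME z. converges_to_point (\<lambda>k. (R ^^ k) M) z)" for M
  have b': "converges_to_point (\<lambda>k. (R ^^ k) M) (b' M)" if "size M = Suc n" for M
    using replace_by_barycentres_converges[OF b that n] someI_ex unfolding b'_def R_def by metis
  have size_R: "size ((R ^^ k) M) = size M" for k M by (simp add: R_def)
  have "barycentre_map (Suc n) b'"
    unfolding barycentre_map_def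
  proof (intro conjI allI impI)
    fix P :: "('a \<times> 'a) multiset" assume P: "size P = Suc n"
    let ?M = "image_mset fst P" and ?N = "image_mset snd P"
    have iter: "\<exists>Q. size Q = Suc n \<and> image_mset fst Q = (R ^^ k) ?M \<and>
        image_mset snd Q = (R ^^ k) ?N \<and> coupling_cost Q \<le> coupling_cost P" for k
    proof (induction k)
      case 0
      then show ?case using P by auto
    next
      case (Suc k)
      then obtain Q where Q: "size Q = Suc n" "image_mset fst Q = (R ^^ k) ?M"
        "image_mset snd Q = (R ^^ k) ?N" "coupling_cost Q \<le> coupling_cost P" by blast
      obtain Q' where "size Q' = Suc n" "image_mset fst Q' = R (image_mset fst Q)"
        "image_mset snd Q' = R (image_mset snd Q)" "coupling_cost Q' \<le> coupling_cost Q"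
        using replace_by_barycentres_coupling[OF b Q(1)] n unfolding R_def by auto
      then show ?case using Q by (intro exI[of _ Q']) auto
    qed
    show "real (Suc n) * dist (b' ?M) (b' ?N) \<le> coupling_cost P"
    proof (rule field_le_epsilon)
      fix e :: real assume "e > 0"
      \<comment> \<open>Each of the \<open>Suc n\<close> pairs of the coupling \<open>Q\<close>
        contributes an error \<open>d\<close> at both ends, and these errors add up to
        \<open>e\<close>.\<close>
      define d where "d = e / (2 * real (Suc n))"
      have "real (Suc n) * (2 * d) = e" by (simp add: d_def del: of_nat_Suc)
      have "d > 0" using \<open>e > 0\<close> by (simp add: d_def)
      then have "\<forall>\<^sub>F k in sequentially. (\<forall>x\<in>#(R ^^ k) ?M. dist x (b' ?M) < d) \<and>
          (\<forall>x\<in>#(R ^^ k) ?N. dist x (b' ?N) < d)"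
        using b'[of ?M] b'[of ?N] P unfolding converges_to_point_def
        by (intro eventually_conj) auto
      then obtain k where k: "\<forall>x\<in>#(R ^^ k) ?M. dist x (b' ?M) < d"
        "\<forall>x\<in>#(R ^^ k) ?N. dist x (b' ?N) < d"
        by (auto simp: eventually_sequentially)
      obtain Q where Q: "size Q = Suc n" "image_mset fst Q = (R ^^ k) ?M"
        "image_mset snd Q = (R ^^ k) ?N" "coupling_cost Q \<le> coupling_cost P"
        using iter by blast
      have "dist (b' ?M) (b' ?N) \<le> 2 * d + dist (fst p) (snd p)" if "p \<in># Q" for p
      proof -
        have "dist (fst p) (b' ?M) < d" "dist (snd p) (b' ?N) < d"
          using k that Q(2,3) by (metis in_image_mset imageI)+
        then show ?thesis
          using dist_triangle3[of "b' ?M" "b' ?N" "fst p"] dist_triangle[of "fst p" "b' ?N" "snd p"]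
          by simp
      qed
      then have "(\<Sum>p\<in>#Q. dist (b' ?M) (b' ?N)) \<le> (\<Sum>p\<in>#Q. 2 * d + dist (fst p) (snd p))"
        by (intro sum_mset_mono) auto
      also have "\<dots> = real (Suc n) * (2 * d) + coupling_cost Q"
        by (simp add: sum_mset.distrib coupling_cost_def Q(1))
      finally show "real (Suc n) * dist (b' ?M) (b' ?N) \<le> coupling_cost P + e"
        using Q(1,4) \<open>real (Suc n) * (2 * d) = e\<close> by simp
    qed
  next
    fix M :: "'a multiset" and C
    assume M: "size M = Suc n" "set_mset M \<subseteq> C" and C: "closed C" "bicombing_convex \<eta> C"
    have R: "set_mset (R N) = (\<lambda>x. b (N - {#x#})) ` set_mset N" for N
      by (simp add: R_def replace_by_barycentres_def)
    have sub: "set_mset ((R ^^ k) M) \<subseteq> C" for k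
    proof (induction k)
      case (Suc k)
      then show ?case
        using size_R[of k M] M(1)
        by (auto simp: R size_Diff_singleton dest: in_diffD intro!: barycentre_map_in[OF b _ _ C])
    qed (use M in simp)
    have "\<exists>y\<in>C. dist y (b' M) < e" if "e > 0" for e
    proof -
      obtain k where "\<forall>x\<in>#(R ^^ k) M. dist x (b' M) < e"
        using b'[OF M(1)] \<open>e > 0\<close> unfolding converges_to_point_def eventually_sequentially
        by (meson order_refl)
      moreover obtain x where "x \<in># (R ^^ k) M"
        using size_R[of k M] M(1) by (metis Zero_not_Suc multiset_nonemptyE size_empty)
      ultimately show ?thesis using sub by blast
    qed
    then show "b' M \<in> C" using closed_approachable[OF C(1)] by blast
  next
    fix M :: "'a multiset" and f
    assume M: "size M = Suc n" and f: "isometry_of_space f" "bicombing_respecting \<eta> f"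
    have R: "R (image_mset f N) = image_mset f (R N)" if "size N = Suc n" for N
    proof -
      have "b (image_mset f N - {#f x#}) = f (b (N - {#x#}))" if "x \<in># N" for x
      proof -
        have "image_mset f N - {#f x#} = image_mset f (N - {#x#})"
          using that by (simp add: image_mset_Diff)
        moreover have "size (N - {#x#}) = n"
          using that \<open>size N = Suc n\<close> by (simp add: size_Diff_singleton)
        ultimately show ?thesis using b f unfolding barycentre_map_def by simp
      qed
      then show ?thesis
        unfolding R_def replace_by_barycentres_def multiset.map_comp comp_def by (rule image_mset_cong)
    qed
    have "(R ^^ k) (image_mset f M) = image_mset f ((R ^^ k) M)" for k
      by (induction k) (simp_all add: R size_R M)
    \<comment> \<open>Since \<open>f\<close> preserves distances, the image iterates shrink to
      \<open>f (b' M)\<close>; uniqueness of the limit then gives equivariance.\<close>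
    then have "converges_to_point (\<lambda>k. (R ^^ k) (image_mset f M)) (f (b' M))"
      using b'[OF M] f(1) by (simp add: converges_to_point_def isometry_of_space_def)
    moreover have "(R ^^ k) (image_mset f M) \<noteq> {#}" for k
      using size_R[of k "image_mset f M"] M by auto
    ultimately show "b' (image_mset f M) = f (b' M)"
      using converges_to_point_unique[OF b'[of "image_mset f M"]] M by auto
  qed
  then show ?thesis by blast
qed

lemma barycentre_map_exists: "n \<ge> 1 \<Longrightarrow> \<exists>b. barycentre_map n b"
proof (induction n rule: dec_induct)
  case base
  show ?case by (rule barycentre_map_1)
next
  case (step n)
  then show ?case
    using barycentre_map_2 barycentre_map_Suc by (cases "n = 1") (auto simp: numeral_2_eq_2)
qed

section \<open>Barycentres of finite sets of equal size\<close>

text \<open>Common points are matched with themselves at no cost. The differences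
  \<open>A - B\<close> and \<open>B - A\<close> have equal cardinality, so the rest is matched by a
  bijection at cost at most \<open>D\<close> per point.\<close>

lemma barycentre_map_dist_finite_sets:
  assumes b: "barycentre_map n b" and A: "finite A" "card A = n" and B: "finite B" "card B = n"
    and D: "\<And>x y. x \<in> A \<Longrightarrow> y \<in> B \<Longrightarrow> dist x y \<le> D"
  shows "real n * dist (b (mset_set A)) (b (mset_set B)) \<le> real (card (A - B)) * D"
proof -
  have "card (A - B) = n - card (A \<inter> B)"
    using A by (simp add: card_Diff_subset_Int)
  moreover have "card (B - A) = n - card (A \<inter> B)"
    using B by (simp add: card_Diff_subset_Int Int_commute[of B A])
  ultimately have "card (A - B) = card (B - A)" by simp
  then obtain h where h: "bij_betw h (A - B) (B - A)"
    using finite_same_card_bij[of "A - B" "B - A"] A B by auto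
  define P where "P = {#(x, x). x \<in># mset_set (A \<inter> B)#} + {#(x, h x). x \<in># mset_set (A - B)#}"
  have "image_mset fst P = mset_set (A \<inter> B) + mset_set (A - B)"
    by (simp add: P_def multiset.map_comp comp_def)
  also have "\<dots> = mset_set A"
    using A by (subst mset_set_Union[symmetric]) (auto simp: Int_Diff_Un)
  finally have fst_P: "image_mset fst P = mset_set A" .
  have "image_mset snd P = mset_set (A \<inter> B) + mset_set (B - A)"
    using h by (simp add: P_def multiset.map_comp comp_def bij_betw_def image_mset_mset_set)
  also have "\<dots> = mset_set B"
    using A B by (subst mset_set_Union[symmetric]) (auto intro: arg_cong[where f = mset_set])
  finally have snd_P: "image_mset snd P = mset_set B" .
  have "size P = n" using A fst_P by (metis size_image_mset size_mset_set)
  then have "real n * dist (b (mset_set A)) (b (mset_set B)) \<le> coupling_cost P"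
    using b unfolding barycentre_map_def by (metis fst_P snd_P)
  also have "\<dots> = (\<Sum>x\<in>#mset_set (A - B). dist x (h x))"
    by (simp add: P_def coupling_cost_def multiset.map_comp comp_def)
  also have "\<dots> \<le> (\<Sum>x\<in>#mset_set (A - B). D)"
    using h D A(1) by (intro sum_mset_mono) (auto simp: bij_betw_def)
  also have "\<dots> = real (card (A - B)) * D" by simp
  finally show ?thesis .
qed

section \<open>Closed convex hulls\<close>

lemma closed_closed_conv: "closed (closed_conv \<eta> A)"
  unfolding closed_conv_def hull_def by (rule closed_Inter) simp

lemma bicombing_convex_closed_conv: "bicombing_convex \<eta> (closed_conv \<eta> A)"
  unfolding bicombing_convex_def
proof (intro ballI)
  fix x y and t :: real
  assume x: "x \<in> closed_conv \<eta> A" and y: "y \<in> closed_conv \<eta> A" and t: "t \<in> {0..1}"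
  have "\<eta> x y t \<in> C" if C: "closed C \<and> bicombing_convex \<eta> C" "A \<subseteq> C" for C
  proof -
    have "closed_conv \<eta> A \<subseteq> C"
      unfolding closed_conv_def by (rule hull_minimal) (use C in auto)
    then show ?thesis
      using x y t C(1) unfolding bicombing_convex_def by (meson subsetD)
  qed
  then show "\<eta> x y t \<in> closed_conv \<eta> A"
    unfolding closed_conv_def hull_def by simp
qed

lemma subset_closed_conv: "A \<subseteq> closed_conv \<eta> A"
  unfolding closed_conv_def by (rule hull_subset)

lemma closed_conv_subset_cball: "A \<subseteq> cball c r \<Longrightarrow> closed_conv \<eta> A \<subseteq> cball c r"
  unfolding closed_conv_def by (rule hull_minimal) (simp_all add: bicombing_convex_cball)

lemma bounded_closed_conv: "bounded A \<Longrightarrow> bounded (closed_conv \<eta> A)"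
proof -
  assume "bounded A"
  then obtain c r where "A \<subseteq> cball c r" unfolding bounded_subset_cball by blast
  then show ?thesis by (rule bounded_subset[OF bounded_cball closed_conv_subset_cball])
qed

section \<open>Almost fixed points from Foelner sets\<close>

text \<open>The point is the barycentre of a Foelner set \<open>A\<close>. By equivariance
  \<open>\<phi> g\<close> moves it to the barycentre of the translate of \<open>A\<close>, and the
  two sets differ in only a small proportion of their points.\<close>

lemma almost_fixed_point:
  assumes G: "group_action G UNIV \<phi>"
    and iso: "\<And>g. g \<in> carrier G \<Longrightarrow> isometry_of_space (\<phi> g) \<and> bicombing_respecting \<eta> (\<phi> g)"
    and bdd: "bounded (orbit G \<phi> x0)"
    and am: "amenable_action G (orbit G \<phi> x0) (\<lambda>g. restrict (\<phi> g) (orbit G \<phi> x0))"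
    and S: "finite S" "S \<subseteq> carrier G" "S \<noteq> {}" and e: "e > 0"
  shows "\<exists>x\<in>closed_conv \<eta> (orbit G \<phi> x0). \<forall>g\<in>S. dist x (\<phi> g x) \<le> e * diameter (orbit G \<phi> x0)"
proof -
  let ?Y = "orbit G \<phi> x0"
  interpret group_action G UNIV \<phi> by fact
  obtain A where A: "finite A" "A \<subseteq> ?Y"
    and Folner: "\<And>g. g \<in> S \<Longrightarrow> real (card (sym_diff A (restrict (\<phi> g) ?Y ` A))) < e * real (card A)"
    using am S e unfolding amenable_action_def by metis
  \<comment> \<open>For empty \<open>A\<close> the strict Foelner inequality at any element of
    \<open>S\<close> would read 0 < 0.\<close>
  have "A \<noteq> {}" using Folner S(3) by fastforce
  then have cA: "card A \<ge> 1" using A(1) by (simp add: Suc_le_eq card_gt_0_iff)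
  then obtain b where b: "barycentre_map (card A) b" using barycentre_map_exists by blast
  define x where "x = b (mset_set A)"
  have "dist x (\<phi> g x) \<le> e * diameter ?Y" if g: "g \<in> S" for g
  proof -
    have gG: "g \<in> carrier G" using S g by blast
    have img: "restrict (\<phi> g) ?Y ` A = \<phi> g ` A" using A by (intro image_cong) auto
    have inj: "inj_on (\<phi> g) A"
      using iso[OF gG] unfolding isometry_of_space_def inj_on_def by (metis dist_eq_0_iff)
    \<comment> \<open>Invariance of the orbit keeps the translate of \<open>A\<close> inside it, so
      its diameter bounds the cost of each matched pair.\<close>
    have gO: "\<phi> g y \<in> ?Y" if "y \<in> ?Y" for y
      using that gG unfolding orbit_def
      by (auto simp: composition_rule[OF UNIV_I gG, symmetric] intro!: group.subgroup_self monoid.m_closed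
          group.is_monoid group_hom.axioms(1)[OF group_hom])
    have "\<phi> g x = b (mset_set (\<phi> g ` A))"
      using b iso[OF gG] inj unfolding barycentre_map_def x_def
      by (metis image_mset_mset_set size_mset_set)
    moreover have "real (card A) * dist x (b (mset_set (\<phi> g ` A))) \<le> real (card (A - \<phi> g ` A)) * diameter ?Y"
      unfolding x_def
      by (rule barycentre_map_dist_finite_sets[OF b])
        (use A inj gO bdd in \<open>auto simp: card_image intro!: diameter_bounded_bound\<close>)
    moreover have "card (A - \<phi> g ` A) \<le> card (sym_diff A (\<phi> g ` A))"
      using A by (intro card_mono) auto
    then have "real (card (A - \<phi> g ` A)) * diameter ?Y \<le> e * real (card A) * diameter ?Y"
      using Folner[OF g] unfolding img by (intro mult_right_mono) (auto simp: diameter_ge_0[OF bdd])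
    ultimately have "real (card A) * dist x (\<phi> g x) \<le> real (card A) * (e * diameter ?Y)"
      by (simp add: mult_ac)
    then show ?thesis using cA by simp
  qed
  moreover have "x \<in> closed_conv \<eta> ?Y"
    using b A subset_closed_conv[of ?Y] closed_closed_conv bicombing_convex_closed_conv
    unfolding barycentre_map_def x_def by auto
  ultimately show ?thesis by blast
qed

end

section \<open>From almost fixed points to a fixed point\<close>

theorem theorem4p12:
  fixes \<eta> :: "'a::complete_space \<Rightarrow> 'a \<Rightarrow> real \<Rightarrow> 'a"
    and \<Gamma> :: "('g, 'r) monoid_scheme"
    and \<phi> :: "'g \<Rightarrow> 'a \<Rightarrow> 'a"
    and x0 :: 'a
  assumes "GCB_space \<eta>"
    and "property_C \<eta>"
    and "group_action \<Gamma> UNIV \<phi>"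
    and "countable (carrier \<Gamma>)"
    and "\<And>g. g \<in> carrier \<Gamma> \<Longrightarrow> isometry_of_space (\<phi> g) \<and> bicombing_respecting \<eta> (\<phi> g)"
    and "bounded (orbit \<Gamma> \<phi> x0)"
    and "amenable_action \<Gamma> (orbit \<Gamma> \<phi> x0) (\<lambda>g. restrict (\<phi> g) (orbit \<Gamma> \<phi> x0))"
  shows "\<exists>z. (\<forall>g\<in>carrier \<Gamma>. \<phi> g z = z) \<and> convex_close z (closed_conv \<eta> (orbit \<Gamma> \<phi> x0))"
proof -
  interpret GCB_space \<eta> by fact
  interpret group_action \<Gamma> UNIV \<phi> by fact
  interpret group \<Gamma> by (rule group_hom.axioms(1)[OF group_hom])
  define Y where "Y = orbit \<Gamma> \<phi> x0"
  define C where "C = closed_conv \<eta> Y"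
  define D where "D = diameter Y"
  have bdd: "bounded Y" "bounded C" using assms(6) by (auto simp: Y_def C_def bounded_closed_conv)
  have x0: "x0 \<in> Y" unfolding Y_def by (rule orbit_refl) simp
  \<comment> \<open>The enumeration may repeat elements, so finite groups are included. Its initial
    segments up to \<open>n\<close> are finite, nonempty and exhaust the group, as
    \<open>almost_fixed_point\<close> requires of its sets \<open>S\<close> along the
    sequence.\<close>
  define enum where "enum = from_nat_into (carrier \<Gamma>)"
  have enum: "range enum = carrier \<Gamma>"
    using assms(4) carrier_not_empty unfolding enum_def by (intro range_from_nat_into) auto
  have "\<exists>x\<in>C. \<forall>g\<in>enum ` {..n}. dist x (\<phi> g x) \<le> (1 / Suc n) * D" for n
    unfolding C_def D_def Y_def
    by (rule almost_fixed_point) (use assms enum in auto)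
  then obtain y where y: "\<And>n. y n \<in> C"
    and fixed: "\<And>n g. g \<in> enum ` {..n} \<Longrightarrow> dist (y n) (\<phi> g (y n)) \<le> (1 / Suc n) * D"
    by metis
  \<comment> \<open>Putting \<open>x0\<close> in front bounds the distance from the fixed point to the orbit itself, not
    only to the barycentres \<open>y n\<close>, which may lie far from the orbit.\<close>
  define x where "x n = (case n of 0 \<Rightarrow> x0 | Suc m \<Rightarrow> y m)" for n
  have xC: "range x \<subseteq> C"
    using y x0 subset_closed_conv[of Y] by (auto simp: x_def C_def split: nat.split)
  have lim: "(\<lambda>n. dist (x n) (\<phi> g (x n))) \<longlonglongrightarrow> 0" if "g \<in> carrier \<Gamma>" for g
  proof -
    have "g \<in> range enum" using enum that by simp
    then obtain m where m: "g = enum m" by (rule imageE)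
    have "(\<lambda>n. dist (y n) (\<phi> g (y n))) \<longlonglongrightarrow> 0"
    proof (rule tendsto_sandwich[where f = "\<lambda>_. 0"])
      show "\<forall>\<^sub>F n in sequentially. dist (y n) (\<phi> g (y n)) \<le> (1 / Suc n) * D"
        \<comment> \<open>The estimate for \<open>g = enum m\<close> is available once the initial
          segment contains the index \<open>m\<close>.\<close>
        using eventually_ge_at_top[of m] 
      proof eventually_elim
        case (elim n)
        then have "g \<in> enum ` {..n}" by (simp add: m)
        then show ?case by (rule fixed)
      qed
      show "(\<lambda>n. (1 / Suc n) * D) \<longlonglongrightarrow> 0"
        using tendsto_mult_left_zero[OF LIMSEQ_inverse_real_of_nat, of D] by (simp add: inverse_eq_divide)
    qed auto
    then show ?thesis
      \<comment> \<open>The limit ignores the term \<open>x0\<close> in front, and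
        \<open>x (Suc n)\<close> is \<open>y n\<close>.\<close>
      by (subst filterlim_sequentially_Suc[symmetric]) (simp add: x_def)
  qed
  have "\<exists>z. convex_close z (range x) \<and> (\<forall>f\<in>\<phi> ` carrier \<Gamma>. f z = z)"
    using assms(2)[unfolded property_C_def, rule_format, of x "\<phi> ` carrier \<Gamma>"]
      bounded_subset[OF bdd(2) xC] assms(5) lim by blast
  then obtain z where z: "convex_close z (range x)" "\<And>g. g \<in> carrier \<Gamma> \<Longrightarrow> \<phi> g z = z" by blast
  have "dist z x0 \<le> diameter (range x)"
    using z(1) unfolding convex_close_def by (metis nat.case(1) rangeI x_def)
  also have "\<dots> \<le> diameter C" by (rule diameter_subset[OF xC bdd(2)])
  finally have close: "dist z x0 \<le> diameter C" .
  \<comment> \<open>A common fixed point of isometries has the same distance to all points of an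
    orbit, so the bound at \<open>x0\<close> holds on all of \<open>Y\<close>. Convexity of balls
    then extends it to the hull \<open>C\<close>.\<close>
  have "dist z (\<phi> g x0) = dist z x0" if "g \<in> carrier \<Gamma>" for g
    using z(2)[OF that] assms(5)[OF that] unfolding isometry_of_space_def by metis
  then have "Y \<subseteq> cball z (diameter C)"
    using close by (auto simp: Y_def orbit_def)
  then have "C \<subseteq> cball z (diameter C)"
    unfolding C_def by (rule closed_conv_subset_cball)
  then have "convex_close z C" by (auto simp: convex_close_def)
  then show ?thesis using z(2) by (auto simp: C_def Y_def)
qed

end
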